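(* Let $2\le p<\infty$. There exist a real-valued function $f\in L^p(\mathbb T)$ with $\int_{\mathbb T}f=0$ and an increasing sequence of positive integers $(n_j)_{j\ge1}$ with $n_{j+1}/n_j\ge2$ for all $j$ such that, for almost every $x\in\mathbb T$, $$\limsup_{N\to\infty}\frac{\sum_{j\le N}f(n_jx)}{N(\log N)^{1/p-\varepsilon}}=+\infty\qquad\text{for every }\varepsilon>0.$$ In particular, taking $p=2$ gives a function $f\in L^2(\mathbb T)$ and such a sequence $(n_j)$ for which it is not true that $\sum_{j\le N}f(n_jx)=o\bigl(N\sqrt{\log\log N}\bigr)$ for almost every $x$.
   Context: $\mathbb T=\mathbb R/\mathbb Z$ with normalized Lebesgue measure. *)

theory Defs
  imports "HOL-Analysis.Analysis" "HOL-Library.Landau_Symbols"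
begin

text \<open>
  Functions on \<open>\<real>/\<int>\<close> are represented by 1-periodic functions on the reals, and the
  normalized Lebesgue measure by Lebesgue measure on the fundamental domain \<open>[0,1)\<close>.
\<close>

definition circle_measure :: "real measure" where
  "circle_measure = lebesgue_on {0..<1}"

definition Lp_circle :: "real \<Rightarrow> (real \<Rightarrow> real) set" where
  "Lp_circle p = {f. (\<forall>x. f (x + 1) = f x) \<and> f \<in> borel_measurable circle_measure \<and>
                     integrable circle_measure (\<lambda>x. \<bar>f x\<bar> powr p)}"

text \<open>Sequences are indexed from 1; the value \<open>n 0\<close> is irrelevant.\<close>

definition lacunary2 :: "(nat \<Rightarrow> nat) \<Rightarrow> bool" where
  "lacunary2 n \<longleftrightarrow> strict_mono_on {1..} n \<and> (\<forall>j\<ge>1. n j > 0) \<and>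
                 (\<forall>j\<ge>1. real (n (Suc j)) / real (n j) \<ge> 2)"

end

theory Submission
  imports Defs "HOL-Probability.Probability_Measure" "HOL-Real_Asymp.Real_Asymp"
begin

text \<open>
  The indices \<open>j\<close> are cut into blocks \<open>2^k \<le> j < 2^(k+1)\<close>, and the blocks into groups
  \<open>2^i \<le> k < 2^(i+1)\<close>. All blocks of group \<open>i\<close> share one set \<open>E\<^sub>i\<close> of measure at most \<open>2 / 2^i\<close>: with
  \<open>B = 2^i M\<close> and \<open>M = 2^(2^(i+1))\<close>, it consists of the points having a zero among their first \<open>2 M\<close>
  digits in base \<open>B\<close>. If a zero occurs among the digits with positions in \<open>[M, 2 M)\<close>, then
  \<open>x, B x, \<dots>, B^(M-1) x\<close> all lie in \<open>E\<^sub>i\<close>, and this event still has measure of order \<open>1 / 2^i\<close>,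
  that is \<open>1 / k\<close>. Choosing the \<open>n\<^sub>j\<close> of block \<open>k\<close> as consecutive powers of \<open>B\<close>, times a power of two
  so large that different blocks look at disjoint windows of binary digits, makes these events
  independent, so almost every \<open>x\<close> lies in infinitely many of them because the harmonic series diverges.
  In such a block \<open>f(n\<^sub>j x)\<close> has size at least \<open>(2^i / (i+1)^2)^(1/p)\<close> for all \<open>j\<close> of the block,
  where \<open>|f|^p\<close> is essentially the integrable function with weight \<open>2^i / (i+1)^2\<close> on each \<open>E\<^sub>i\<close>,
  and \<open>log N\<close> is of order \<open>2^i\<close>.
\<close>

section \<open>The unit interval as a probability space\<close>

lemma space_circle [simp]: "space circle_measure = {0..<1}"
  by (simp add: circle_measure_def)

lemma borel_measurable_circle: "f \<in> borel_measurable borel \<Longrightarrow> f \<in> borel_measurable circle_measure"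
  unfolding circle_measure_def
  by (intro measurable_restrict_space1) (simp add: measurable_completion)

lemma sets_circleI:
  assumes "A \<in> sets borel" "A \<subseteq> {0..<1}"
  shows "A \<in> sets circle_measure"
  using assms unfolding circle_measure_def by (auto simp: sets_restrict_space_iff)

lemma measure_circle: "A \<in> sets borel \<Longrightarrow> A \<subseteq> {0..<1} \<Longrightarrow> measure circle_measure A = measure lborel A"
  unfolding circle_measure_def by (subst measure_restrict_space) auto

lemma prob_space_circle: "prob_space circle_measure"
  by (rule prob_spaceI) (simp add: circle_measure_def emeasure_restrict_space)

interpretation circle: prob_space circle_measure
  by (rule prob_space_circle)

section \<open>Binary digits\<close>

text \<open>The binary digits of \<open>x\<close> at the positions \<open>a + 1, \<dots>, a + h\<close> after the point vanish.\<close>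

definition zero_digits :: "nat \<Rightarrow> nat \<Rightarrow> real set" where
  "zero_digits a h = {x. \<lfloor>2 ^ (a + h) * x\<rfloor> mod 2 ^ h = 0}"

text \<open>A union of dyadic intervals, indexed by integers so that measures become
  cardinalities.\<close>

definition digit_set :: "nat \<Rightarrow> int set \<Rightarrow> real set" where
  "digit_set a C = {x. \<lfloor>2 ^ a * x\<rfloor> \<in> C}"

text \<open>Membership in the finite sigma-algebra that the first \<open>a\<close> binary digits
  generate on the unit interval.\<close>

definition determined :: "nat \<Rightarrow> real set \<Rightarrow> bool" where
  "determined a D \<longleftrightarrow> (\<exists>C \<subseteq> {0..<2^a}. D = digit_set a C)"

lemma zero_digits_mult [simp]: "2 ^ b * x \<in> zero_digits a h \<longleftrightarrow> x \<in> zero_digits (a + b) h"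
  by (simp add: zero_digits_def power_add mult_ac)

lemma zero_digits_periodic [simp]: "x + 1 \<in> zero_digits a h \<longleftrightarrow> x \<in> zero_digits a h"
proof -
  have "\<lfloor>2 ^ (a + h) * (x + 1)\<rfloor> = \<lfloor>2 ^ (a + h) * x + of_int (2 ^ (a + h))\<rfloor>"
    by (simp add: algebra_simps)
  also have "\<dots> = \<lfloor>2 ^ (a + h) * x\<rfloor> + 2 ^ a * 2 ^ h"
    by (simp only: floor_add_int [symmetric] power_add)
  finally show ?thesis by (simp add: zero_digits_def)
qed

lemma zero_digits_borel [measurable]: "zero_digits a h \<in> sets borel"
  unfolding zero_digits_def by measurable

lemma floor_shift: "\<lfloor>2 ^ (a + d) * x :: real\<rfloor> div 2 ^ d = \<lfloor>2 ^ a * x\<rfloor>"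
  using floor_divide_real_eq_div[of "2 ^ d" "2 ^ (a + d) * x"] by (simp add: power_add)

lemma digit_set_singleton: "digit_set a {c} = {of_int c / 2 ^ a ..< (of_int c + 1) / 2 ^ a}"
  by (auto simp: digit_set_def field_simps floor_eq_iff)

lemma digit_set_UN: "digit_set a C = (\<Union>c\<in>C. digit_set a {c})"
  by (auto simp: digit_set_def)

lemma digit_set_mono: "C \<subseteq> C' \<Longrightarrow> digit_set a C \<subseteq> digit_set a C'"
  by (auto simp: digit_set_def)

lemma digit_set_borel [measurable]: "digit_set a C \<in> sets borel"
  unfolding digit_set_def by measurable

lemma digit_set_atLeastLessThan: "digit_set a {0..<2^a} = {0..<1}"
proof -
  have "0 \<le> \<lfloor>2 ^ a * x\<rfloor> \<longleftrightarrow> 0 \<le> x" "\<lfloor>2 ^ a * x\<rfloor> < 2 ^ a \<longleftrightarrow> x < 1" for x :: real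
    using mult_le_cancel_left_pos[of "2 ^ a" 0 x] by (simp_all add: floor_less_iff)
  then show ?thesis
    by (simp only: digit_set_def set_eq_iff mem_Collect_eq atLeastLessThan_iff) simp
qed

lemma measure_digit_set:
  assumes "C \<subseteq> {0..<2^a}"
  shows "measure circle_measure (digit_set a C) = card C / 2 ^ a"
proof -
  have sub: "digit_set a C \<subseteq> {0..<1}"
    using digit_set_mono[OF assms, of a] by (simp add: digit_set_atLeastLessThan)
  have fin: "finite C" using assms finite_subset by blast
  have "measure circle_measure (digit_set a C) = measure lborel (\<Union>c\<in>C. digit_set a {c})"
    using measure_circle[OF _ sub] by (simp flip: digit_set_UN)
  also have "\<dots> = (\<Sum>c\<in>C. measure lborel (digit_set a {c}))"
  proof (rule measure_finite_Union)
    show "disjoint_family_on (\<lambda>c. digit_set a {c}) C"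
      by (auto simp: disjoint_family_on_def digit_set_def)
    show "emeasure lborel (digit_set a {c}) \<noteq> \<infinity>" for c
      by (simp add: digit_set_singleton divide_right_mono)
  qed (use fin in auto)
  also have "\<dots> = (\<Sum>c\<in>C. 1 / 2 ^ a)"
    by (intro sum.cong) (auto simp: digit_set_singleton divide_simps)
  finally show ?thesis by simp
qed

lemma determined_subset: "determined a D \<Longrightarrow> D \<subseteq> {0..<1}"
  unfolding determined_def by (elim exE conjE) (metis digit_set_mono digit_set_atLeastLessThan)

lemma determined_unit_interval: "determined a {0..<1}"
  unfolding determined_def using digit_set_atLeastLessThan[of a] by blast

lemma determined_mono:
  assumes "determined a D" "a \<le> b"
  shows "determined b D"
proof -
  obtain C where C: "C \<subseteq> {0..<2^a}" "D = digit_set a C"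
    using assms by (auto simp: determined_def)
  obtain d where b: "b = a + d" using assms le_Suc_ex by blast
  \<comment> \<open>Intersecting with the unit interval keeps the new index set below
    \<open>2 ^ b\<close>; \<open>m div 2 ^ d\<close> drops the last \<open>d\<close> digits of
    \<open>m\<close>.\<close>
  have "D = digit_set b {0..<2^b} \<inter> D"
    using determined_subset[OF assms(1)] digit_set_atLeastLessThan[of b] by auto
  also have "\<dots> = digit_set b ({0..<2^b} \<inter> {m. m div 2 ^ d \<in> C})"
    by (auto simp: C digit_set_def b floor_shift)
  finally have "D = digit_set b ({0..<2^b} \<inter> {m. m div 2 ^ d \<in> C})" .
  then show ?thesis unfolding determined_def using Int_lower1 by blast
qed

text \<open>A run of digits is independent of everything that precedes it.\<close>

lemma determined_diff_zero_digits:
  assumes "determined a D"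
  shows "determined (a + h) (D - zero_digits a h)"
    and "measure circle_measure (D - zero_digits a h) = measure circle_measure D * (1 - 1 / 2 ^ h)"
proof -
  obtain C where C: "C \<subseteq> {0..<2^a}" "D = digit_set a C"
    using assms by (auto simp: determined_def)
  \<comment> \<open>Prefixes from \<open>C\<close> followed by \<open>h\<close> digits that are not
    all zero, hence \<open>d\<close> starts at 1. Counting these pairs produces the factor
    \<open>2 ^ h - 1\<close>.\<close>
  define C' where "C' = (\<lambda>(c, d). c * 2 ^ h + d) ` (C \<times> {1..<2 ^ h :: int})"
  have C'_iff: "m \<in> C' \<longleftrightarrow> m div 2 ^ h \<in> C \<and> m mod 2 ^ h \<noteq> 0" for m
  proof
    assume "m div 2 ^ h \<in> C \<and> m mod 2 ^ h \<noteq> 0"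
    moreover have "m mod 2 ^ h \<ge> 0" "m mod 2 ^ h < 2 ^ h" by simp_all
    ultimately have "(m div 2 ^ h, m mod 2 ^ h) \<in> C \<times> {1..<2 ^ h}"
      by (metis SigmaI atLeastLessThan_iff int_one_le_iff_zero_less order_le_less)
    then show "m \<in> C'"
      unfolding C'_def by (rule rev_image_eqI) (simp only: prod.case div_mult_mod_eq)
  next
    assume "m \<in> C'"
    then obtain c d where "c \<in> C" "1 \<le> d" "d < 2 ^ h" "m = c * 2 ^ h + d"
      by (auto simp: C'_def)
    then show "m div 2 ^ h \<in> C \<and> m mod 2 ^ h \<noteq> 0" by simp
  qed
  have eq: "D - zero_digits a h = digit_set (a + h) C'"
    by (auto simp: C digit_set_def C'_iff floor_shift zero_digits_def)
  have sub: "C' \<subseteq> {0..<2 ^ (a + h)}"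
  proof
    fix m assume "m \<in> C'"
    then have "m div 2 ^ h \<ge> 0" "m div 2 ^ h < 2 ^ a" using C(1) by (auto simp: C'_iff)
    moreover have "m div 2 ^ h * 2 ^ h + m mod 2 ^ h = m" "0 \<le> m mod 2 ^ h" "m mod 2 ^ h < 2 ^ h"
      by (rule div_mult_mod_eq) simp_all
    moreover have "(m div 2 ^ h + 1) * 2 ^ h \<le> 2 ^ a * 2 ^ h"
      using \<open>m div 2 ^ h < 2 ^ a\<close> by (intro mult_right_mono) auto
    moreover have "0 \<le> m div 2 ^ h * 2 ^ h"
      using \<open>0 \<le> m div 2 ^ h\<close> by simp
    ultimately have "0 \<le> m" "m < 2 ^ a * 2 ^ h" unfolding distrib_right by linarith+
    then show "m \<in> {0..<2 ^ (a + h)}" by (simp add: power_add)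
  qed
  show "determined (a + h) (D - zero_digits a h)"
    unfolding determined_def using eq sub by blast
  have "inj_on (\<lambda>(c, d). c * 2 ^ h + d) (C \<times> {1..<2 ^ h :: int})"
  proof (rule inj_onI, clarsimp)
    fix c d c' d' :: int
    assume *: "1 \<le> d" "d < 2 ^ h" "1 \<le> d'" "d' < 2 ^ h" "c * 2 ^ h + d = c' * 2 ^ h + d'"
    then have "(c * 2 ^ h + d) div 2 ^ h = (c' * 2 ^ h + d') div 2 ^ h" by simp
    then have "c = c'" using *(1-4) by simp
    then show "c = c' \<and> d = d'" using * by simp
  qed
  then have "card C' = card C * (2 ^ h - 1)"
    unfolding C'_def by (subst card_image) (auto simp: card_cartesian_product nat_diff_distrib nat_power_eq)
  then show "measure circle_measure (D - zero_digits a h) = measure circle_measure D * (1 - 1 / 2 ^ h)"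
    unfolding eq measure_digit_set[OF sub] unfolding C(2) measure_digit_set[OF C(1)]
    by (simp add: of_nat_diff power_add field_simps)
qed

lemma measure_zero_digits: "measure circle_measure ({0..<1} \<inter> zero_digits a h) = 1 / 2 ^ h"
proof -
  have "measure circle_measure ({0..<1} - {0..<1} \<inter> zero_digits a h) = 1 - 1 / 2 ^ h"
    using determined_diff_zero_digits(2)[OF determined_unit_interval, of a h] circle.prob_space
    by (simp add: Diff_Int)
  moreover have "{0..<1} \<inter> zero_digits a h \<in> sets circle_measure" by (intro sets_circleI) auto
  ultimately show ?thesis using circle.prob_compl by simp
qed

text \<open>The runs occupy consecutive disjoint windows, so each removal contributes its own
  factor. The offset \<open>m\<close> only skips digits, which changes no measure.\<close>

lemma determined_diff_zero_runs:
  assumes "determined a D"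
  shows "determined (a + (m + n) * h) (D - (\<Union>t\<in>{m..<m + n}. zero_digits (a + t * h) h)) \<and>
    measure circle_measure (D - (\<Union>t\<in>{m..<m + n}. zero_digits (a + t * h) h))
      = measure circle_measure D * (1 - 1 / 2 ^ h) ^ n"
proof (induction n)
  case 0
  then show ?case using determined_mono[OF assms] by simp
next
  case (Suc n)
  let ?D = "D - (\<Union>t\<in>{m..<m + n}. zero_digits (a + t * h) h)"
  have "D - (\<Union>t\<in>{m..<m + Suc n}. zero_digits (a + t * h) h) = ?D - zero_digits (a + (m + n) * h) h"
    by (auto simp: less_Suc_eq)
  then show ?case
    using determined_diff_zero_digits[of "a + (m + n) * h" ?D h] Suc.IH by (simp add: algebra_simps)
qed

section \<open>Blocks\<close>

definition runs :: "nat \<Rightarrow> nat" where "runs i = 2 ^ 2 ^ Suc i"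

text \<open>The binary logarithm of the base B = \<open>2 ^ i * runs i\<close>: one digit in base B
  is a run of this many bits.\<close>

definition run_len :: "nat \<Rightarrow> nat" where "run_len i = 2 ^ Suc i + i"

definition spike :: "nat \<Rightarrow> real set" where
  "spike i = (\<Union>t<2 * runs i. zero_digits (t * run_len i) (run_len i))"

text \<open>Block \<open>k\<close> reserves room for \<open>2 * runs\<close> digits in base B, which
  covers all windows of \<open>hit k\<close>; hence different blocks look at disjoint bits.\<close>

fun start :: "nat \<Rightarrow> nat" where
  "start 0 = 0"
| "start (Suc k) = start k + 2 * runs (floor_log k) * run_len (floor_log k)"

definition hit :: "nat \<Rightarrow> real set" where
  "hit k = (\<Union>t\<in>{runs (floor_log k)..<2 * runs (floor_log k)}.
     zero_digits (start k + t * run_len (floor_log k)) (run_len (floor_log k)))"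

definition dilation_exp :: "nat \<Rightarrow> nat" where
  "dilation_exp j = start (floor_log j) + (j - 2 ^ floor_log j) * run_len (floor_log (floor_log j))"

text \<open>Block \<open>k\<close> shifts by fewer than \<open>2 ^ k\<close> digits in base B, so a
  zero at a position from \<open>runs\<close> on survives every shift. This is why
  \<open>runs\<close> is doubly exponential.\<close>

lemma power_le_runs: "2 ^ k \<le> runs (floor_log k)"
proof -
  have "k \<le> 2 ^ Suc (floor_log k)" using floor_log_exp2_ge[of k] by simp
  then show ?thesis unfolding runs_def by (intro power_increasing) auto
qed

lemma runs_div: "real (runs i) / 2 ^ run_len i = 1 / 2 ^ i"
  by (simp add: runs_def run_len_def power_add)

lemma dilation_exp_block:
  assumes "2 ^ k \<le> j" "j < 2 ^ Suc k"
  shows "dilation_exp j = start k + (j - 2 ^ k) * run_len (floor_log k)"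
proof -
  have "floor_log j = k" by (rule floor_log_eqI) (use assms in auto)
  then show ?thesis by (simp add: dilation_exp_def)
qed

lemma dilation_exp_Suc:
  assumes "1 \<le> j"
  shows "dilation_exp j < dilation_exp (Suc j)"
proof -
  define k where "k = floor_log j"
  have k: "2 ^ k \<le> j" "j < 2 ^ Suc k"
    using assms floor_log_exp2_le[of j] floor_log_exp2_gt[of j] by (auto simp: k_def)
  let ?h = "run_len (floor_log k)"
  have h: "?h > 0" by (simp add: run_len_def)
  show ?thesis
  proof (cases "Suc j < 2 ^ Suc k")
    case True
    with k h show ?thesis
      by (simp add: dilation_exp_block[of k] Suc_diff_le)
  next
    case False
    then have "Suc j = 2 ^ Suc k" using k by simp
    then have "dilation_exp (Suc j) = start (Suc k)" by (simp add: dilation_exp_block[of "Suc k"])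
    \<comment> \<open>At the last index of a block the exponent is still inside the stretch reserved
      for that block.\<close>
    moreover have "j - 2 ^ k < 2 * runs (floor_log k)"
      using k power_le_runs[of k] by simp
    ultimately show ?thesis
      using h k by (simp add: dilation_exp_block[of k])
  qed
qed

lemma lacunary2_power_dilation_exp: "lacunary2 (\<lambda>j. 2 ^ dilation_exp j)"
proof -
  have mono: "dilation_exp i < dilation_exp j" if "1 \<le> i" "i < j" for i j
    using that(2,1)
  proof (induction rule: strict_inc_induct)
    case (base i)
    then show ?case using dilation_exp_Suc by blast
  next
    case (step i)
    then show ?case using dilation_exp_Suc[of i] by simp
  qed
  have "2 * 2 ^ dilation_exp j \<le> (2 :: real) ^ dilation_exp (Suc j)" if "1 \<le> j" for j
    using power_increasing[of "Suc (dilation_exp j)" "dilation_exp (Suc j)" "2::real"]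
      dilation_exp_Suc[OF that] by simp
  then show ?thesis
    unfolding lacunary2_def strict_mono_on_def by (auto simp: mono field_simps)
qed

text \<open>The dilation discards \<open>start k\<close> bits and then \<open>j - 2 ^ k\<close>
  digits in base B, moving the zero from position \<open>t\<close> to
  \<open>t - (j - 2 ^ k)\<close>, which stays between 0 and \<open>2 * runs\<close>.\<close>

lemma hit_imp_spike:
  assumes "x \<in> hit k" "2 ^ k \<le> j" "j < 2 ^ Suc k"
  shows "2 ^ dilation_exp j * x \<in> spike (floor_log k)"
proof -
  let ?h = "run_len (floor_log k)" and ?N = "runs (floor_log k)"
  obtain t where t: "?N \<le> t" "t < 2 * ?N" "x \<in> zero_digits (start k + t * ?h) ?h"
    using assms(1) by (auto simp: hit_def)
  have le: "j - 2 ^ k \<le> t" using assms power_le_runs[of k] t(1) by simp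
  then have "start k + t * ?h = (t - (j - 2 ^ k)) * ?h + dilation_exp j"
    using dilation_exp_block[OF assms(2,3)] by (simp flip: add_mult_distrib)
  then have "2 ^ dilation_exp j * x \<in> zero_digits ((t - (j - 2 ^ k)) * ?h) ?h"
    using t(3) by simp
  then show ?thesis using t(2) unfolding spike_def by (intro UN_I[of "t - (j - 2 ^ k)"]) auto
qed

section \<open>Spikes are rare\<close>

lemma spike_periodic [simp]: "x + 1 \<in> spike i \<longleftrightarrow> x \<in> spike i"
  by (simp add: spike_def)

lemma spike_borel [measurable]: "spike i \<in> sets borel"
  by (simp add: spike_def)

text \<open>Union bound over the windows; a dilation merely moves them, so the bound is free of
  \<open>b\<close>.\<close>

lemma measure_dilated_spike:
  "measure circle_measure {x\<in>{0..<1}. 2 ^ b * x \<in> spike i} \<le> 2 / 2 ^ i"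
proof -
  let ?Z = "\<lambda>t. {0..<1} \<inter> zero_digits (t * run_len i + b) (run_len i)"
  have "{x\<in>{0..<1}. 2 ^ b * x \<in> spike i} = (\<Union>t<2 * runs i. ?Z t)"
    by (auto simp: spike_def)
  also have "measure circle_measure \<dots> \<le> (\<Sum>t<2 * runs i. measure circle_measure (?Z t))"
    by (intro circle.finite_measure_subadditive_finite) (auto intro!: sets_circleI)
  also have "\<dots> = 2 * (runs i / 2 ^ run_len i)"
    by (simp add: measure_zero_digits)
  finally show ?thesis by (simp add: runs_div)
qed

text \<open>First Borel-Cantelli lemma for each of countably many \<open>b\<close>. Treating all
  dilations at once makes the series of weighted spikes a finite sum at every point
  \<open>2 ^ b * x\<close>.\<close>

lemma AE_finitely_many_spikes:
  "AE x in circle_measure. \<forall>b. \<forall>\<^sub>F i in sequentially. 2 ^ b * x \<notin> spike i"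
proof (subst AE_all_countable, rule allI)
  fix b :: nat
  let ?A = "\<lambda>i. {x\<in>{0..<1}. 2 ^ b * x \<in> spike i}"
  have "summable (\<lambda>i. 2 * (1 / 2) ^ i :: real)" by (intro summable_mult summable_geometric) simp
  then have "summable (\<lambda>i. measure circle_measure (?A i))"
    by (rule summable_comparison_test') (use measure_dilated_spike in \<open>simp add: power_one_over\<close>)
  then have "AE x in circle_measure. \<forall>\<^sub>F i in sequentially. x \<in> space circle_measure - ?A i"
    by (intro borel_cantelli_AE1) (auto intro!: sets_circleI simp: less_top[symmetric])
  then show "AE x in circle_measure. \<forall>\<^sub>F i in sequentially. 2 ^ b * x \<notin> spike i"
    by (rule AE_mp) (auto intro!: AE_I2 elim: eventually_mono)
qed

section \<open>Hits recur almost surely\<close>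

text \<open>Earlier blocks are determined by the bits before \<open>start ?k\<close>, so the
  probabilities of missing multiply. Each factor is bounded through
  \<open>1 - y \<le> exp (- y)\<close>.\<close>

lemma measure_miss_le:
  assumes "1 \<le> m"
  shows "determined (start (m + n)) ({0..<1} - (\<Union>k\<in>{m..<m + n}. hit k)) \<and>
    measure circle_measure ({0..<1} - (\<Union>k\<in>{m..<m + n}. hit k)) \<le> exp (- (\<Sum>k\<in>{m..<m + n}. 1 / real k))"
proof (induction n)
  case 0
  then show ?case using determined_unit_interval circle.prob_space by simp
next
  case (Suc n)
  let ?D = "{0..<1} - (\<Union>k\<in>{m..<m + n}. hit k)" and ?k = "m + n"
  let ?i = "floor_log ?k"
  let ?h = "run_len ?i" and ?N = "runs ?i"
  have D: "{0..<1} - (\<Union>k\<in>{m..<m + Suc n}. hit k) = ?D - hit ?k"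
    by (auto simp: less_Suc_eq)
  have hit: "hit ?k = (\<Union>t\<in>{?N..<?N + ?N}. zero_digits (start ?k + t * ?h) ?h)"
    by (simp add: hit_def mult_2)
  have "(1 - 1 / 2 ^ ?h) ^ ?N \<le> exp (- (1 / 2 ^ ?h) :: real) ^ ?N"
    using exp_ge_add_one_self[of "- (1 / 2 ^ ?h)"] by (intro power_mono) auto
  also have "\<dots> = exp (- (real ?N / 2 ^ ?h))" by (simp flip: exp_of_nat_mult)
  also have "\<dots> \<le> exp (- (1 / real ?k))"
  proof -
    \<comment> \<open>The expected number of zero digits, \<open>1 / 2 ^ ?i\<close>, is at least
      \<open>1 / ?k\<close> because \<open>?k\<close> lies in group \<open>?i\<close>.\<close>
    have "2 ^ ?i \<le> ?k" using assms floor_log_exp2_le[of ?k] by simp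
    then have "2 ^ ?i \<le> real ?k" by (metis of_nat_le_iff of_nat_numeral of_nat_power)
    then show ?thesis unfolding runs_div using assms by (simp add: field_simps)
  qed
  finally have q: "(1 - 1 / 2 ^ ?h) ^ ?N \<le> exp (- (1 / real ?k))" .
  have *: "determined (start ?k + (?N + ?N) * ?h) (?D - hit ?k)"
     "measure circle_measure (?D - hit ?k) = measure circle_measure ?D * (1 - 1 / 2 ^ ?h) ^ ?N"
    using determined_diff_zero_runs[of "start ?k" ?D ?N ?N ?h] Suc.IH unfolding hit by auto
  have "measure circle_measure ?D * (1 - 1 / 2 ^ ?h) ^ ?N
      \<le> exp (- (\<Sum>k\<in>{m..<m + n}. 1 / real k)) * exp (- (1 / real ?k))"
    using Suc.IH q by (intro mult_mono) (auto simp: zero_le_power)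
  also have "\<dots> = exp (- (\<Sum>k\<in>{m..<m + Suc n}. 1 / real k))"
    by (simp flip: exp_add)
  finally show ?case unfolding D using * by (simp add: mult_2)
qed

text \<open>Second Borel-Cantelli argument: were missing all blocks from \<open>m\<close> on of
  positive measure, its logarithm would bound the partial sums of the harmonic series.\<close>

lemma AE_infinitely_many_hits: "AE x in circle_measure. \<exists>\<^sub>F k in sequentially. x \<in> hit k"
proof -
  have hit_borel: "hit k \<in> sets borel" for k by (simp add: hit_def)
  have "AE x in circle_measure. \<exists>k\<ge>m. x \<in> hit k" if m: "1 \<le> m" for m
  proof -
    let ?A = "\<lambda>n. {0..<1} - (\<Union>k\<in>{m..<m + n}. hit k)"
    let ?B = "{0..<1} - (\<Union>k\<in>{m..}. hit k)"
    have "measure circle_measure ?B \<le> exp (- (\<Sum>k\<in>{m..<m + n}. 1 / real k))" for n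
    proof -
      have "measure circle_measure ?B \<le> measure circle_measure (?A n)"
        by (intro circle.finite_measure_mono sets_circleI sets.Diff sets.finite_UN) (auto simp: hit_borel)
      then show ?thesis using measure_miss_le[OF m, of n] by linarith
    qed
    moreover have "(\<Sum>k\<in>{m..<m + n}. 1 / real k) = (\<Sum>k<n. 1 / real (k + m))" for n
      by (rule sum.reindex_bij_witness[of _ "\<lambda>k. k + m" "\<lambda>k. k - m"]) auto
    ultimately have le: "measure circle_measure ?B \<le> exp (- (\<Sum>k<n. 1 / real (k + m)))" for n
      by metis
    have "measure circle_measure ?B = 0"
    proof (rule ccontr)
      assume "measure circle_measure ?B \<noteq> 0"
      then have pos: "0 < measure circle_measure ?B" by (simp add: zero_less_measure_iff)
      have "(\<Sum>k<n. 1 / real (k + m)) \<le> - ln (measure circle_measure ?B)" for n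
        using ln_mono[OF le[of n] pos] by simp
      then have "summable (\<lambda>k. 1 / real (k + m))"
        by (intro summableI_nonneg_bounded) auto
      then show False
        using not_summable_harmonic[where 'a = real] summable_iff_shift[of "\<lambda>k. 1 / real k" m]
        by (simp add: inverse_eq_divide)
    qed
    moreover have "?B \<in> sets circle_measure" by (intro sets_circleI sets.Diff sets.countable_UN') (auto simp: hit_borel)
    ultimately have "AE x in circle_measure. x \<notin> ?B"
      by (intro AE_not_in null_setsI) (auto simp: circle.emeasure_eq_measure)
    then show ?thesis by (rule AE_mp) (auto intro!: AE_I2)
  qed
  then have "AE x in circle_measure. \<forall>m\<ge>1. \<exists>k\<ge>m. x \<in> hit k"
    by (simp add: AE_all_countable)
  then show ?thesis
  proof (rule AE_mp, intro AE_I2 impI)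
    fix x assume *: "\<forall>m\<ge>1. \<exists>k\<ge>m. x \<in> hit k"
    show "\<exists>\<^sub>F k in sequentially. x \<in> hit k"
      unfolding frequently_sequentially
    proof
      fix m
      obtain k where "Suc m \<le> k" "x \<in> hit k" using *[rule_format, of "Suc m"] by auto
      then show "\<exists>k\<ge>m. x \<in> hit k" by (intro exI[of _ k]) simp
    qed
  qed
qed

section \<open>The function\<close>

text \<open>Junk at points lying in infinitely many spikes, which form a null set.\<close>

definition weighted_spikes :: "real \<Rightarrow> real" where
  "weighted_spikes x = (\<Sum>i. 2 ^ i / (real i + 1)\<^sup>2 * indicator (spike i) x)"

lemma weighted_spikes_borel [measurable]: "weighted_spikes \<in> borel_measurable borel"
  unfolding weighted_spikes_def by measurable

lemma weighted_spikes_periodic [simp]: "weighted_spikes (x + 1) = weighted_spikes x"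
  by (simp add: weighted_spikes_def indicator_def)

lemma summable_weighted_spikes:
  assumes "\<forall>\<^sub>F i in sequentially. x \<notin> spike i"
  shows "summable (\<lambda>i. 2 ^ i / (real i + 1)\<^sup>2 * indicator (spike i) x :: real)"
proof -
  have "\<forall>\<^sub>F i in sequentially. 2 ^ i / (real i + 1)\<^sup>2 * indicator (spike i) x = (0::real)"
    using assms by (rule eventually_mono) simp
  from summable_cong[OF this] show ?thesis by simp
qed

lemma weighted_spikes_nonneg:
  assumes "\<forall>\<^sub>F i in sequentially. x \<notin> spike i"
  shows "0 \<le> weighted_spikes x"
  unfolding weighted_spikes_def by (intro suminf_nonneg summable_weighted_spikes assms) auto

lemma weighted_spikes_ge:
  assumes "\<forall>\<^sub>F i in sequentially. x \<notin> spike i" "x \<in> spike i"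
  shows "2 ^ i / (real i + 1)\<^sup>2 \<le> weighted_spikes x"
  using sum_le_suminf[OF summable_weighted_spikes[OF assms(1)], of "{i}"] assms(2)
  by (simp add: weighted_spikes_def)

lemma AE_finitely_many_spikes_0: "AE x in circle_measure. \<forall>\<^sub>F i in sequentially. x \<notin> spike i"
  using AE_finitely_many_spikes by (rule AE_mp) (auto intro!: AE_I2 dest: spec[of _ 0])

text \<open>Termwise integration: the weight times the measure bound \<open>2 / 2 ^ i\<close> leaves
  \<open>2 / (i + 1)^2\<close>. The denominator buys summability at the price of a polynomial in
  \<open>i\<close>.\<close>

lemma integrable_weighted_spikes: "integrable circle_measure weighted_spikes"
  unfolding weighted_spikes_def
proof (rule integrable_suminf)
  let ?w = "\<lambda>i. 2 ^ i / (real i + 1)\<^sup>2"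
  have norm: "norm (?w i * indicator A x) = ?w i * indicator A x" for i A and x :: real
    by (simp add: indicator_def)
  \<comment> \<open>Spikes are periodic subsets of the line; only their traces on the unit interval
    are sets of \<open>circle_measure\<close>.\<close>
  have restrict: "?w i * indicator (spike i) x = ?w i * indicator {x\<in>{0..<1}. x \<in> spike i} x"
    if "x \<in> space circle_measure" for i x
    using that by (simp add: indicator_def)
  have sets: "{x\<in>{0..<1}. x \<in> spike i} \<in> sets circle_measure" for i
    by (rule sets_circleI) auto
  have int: "integrable circle_measure (\<lambda>x. ?w i * indicator {x\<in>{0..<1}. x \<in> spike i} x)" for i
    by (intro integrable_mult_right integrable_real_indicator sets) (simp add: less_top[symmetric])
  show "integrable circle_measure (\<lambda>x. ?w i * indicator (spike i) x)" for i
    by (rule Bochner_Integration.integrable_cong[THEN iffD2, OF refl restrict int])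
  show "AE x in circle_measure. summable (\<lambda>i. norm (?w i * indicator (spike i) x))"
    unfolding norm using AE_finitely_many_spikes_0 by eventually_elim (rule summable_weighted_spikes)
  have eq: "(\<integral>x. norm (?w i * indicator (spike i) x) \<partial>circle_measure)
      = ?w i * measure circle_measure {x\<in>{0..<1}. x \<in> spike i}" for i
  proof -
    have "(\<integral>x. ?w i * indicator (spike i) x \<partial>circle_measure)
        = (\<integral>x. ?w i * indicator {x\<in>{0..<1}. x \<in> spike i} x \<partial>circle_measure)"
      by (rule Bochner_Integration.integral_cong[OF refl restrict])
    also have "\<dots> = ?w i * measure circle_measure ({x\<in>{0..<1}. x \<in> spike i} \<inter> space circle_measure)"
      by (simp only: integral_mult_right_zero Bochner_Integration.integral_indicator)
    also have "{x\<in>{0..<1}. x \<in> spike i} \<inter> space circle_measure = {x\<in>{0..<1}. x \<in> spike i}" by auto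
    finally show ?thesis unfolding norm .
  qed
  have le: "?w i * measure circle_measure {x\<in>{0..<1}. x \<in> spike i} \<le> ?w i * (2 / 2 ^ i)" for i
    using measure_dilated_spike[of 0 i] by (intro mult_left_mono) auto
  have "summable (\<lambda>i. 2 * (1 / (real i + 1)\<^sup>2))"
  proof (rule summable_mult)
    have "summable (\<lambda>i. inverse (real (Suc i) ^ 2))"
      by (subst summable_Suc_iff) (rule inverse_power_summable, simp)
    then show "summable (\<lambda>i. 1 / (real i + 1)\<^sup>2)" by (simp add: inverse_eq_divide add.commute)
  qed
  then show "summable (\<lambda>i. \<integral>x. norm (?w i * indicator (spike i) x) \<partial>circle_measure)"
  proof (rule summable_comparison_test'[of "\<lambda>i. 2 * (1 / (real i + 1)\<^sup>2)" 0])
    fix i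
    have "?w i * (2 / 2 ^ i) = 2 * (1 / (real i + 1)\<^sup>2)" by simp
    then show "norm (\<integral>x. norm (?w i * indicator (spike i) x) \<partial>circle_measure) \<le> 2 * (1 / (real i + 1)\<^sup>2)"
      unfolding eq using le[of i] by simp
  qed
qed

section \<open>The p-th root and its centred version\<close>

definition spiky :: "real \<Rightarrow> real \<Rightarrow> real" where
  "spiky p x = weighted_spikes x powr (1 / p)"

lemma spiky_borel [measurable]: "spiky p \<in> borel_measurable borel"
  unfolding spiky_def by measurable

lemma powr_diff_le:
  fixes a b p :: real
  assumes "0 \<le> p"
  shows "\<bar>a - b\<bar> powr p \<le> 2 powr p * (\<bar>a\<bar> powr p + \<bar>b\<bar> powr p)"
proof -
  let ?m = "max \<bar>a\<bar> \<bar>b\<bar>"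
  have "\<bar>a - b\<bar> powr p \<le> (2 * ?m) powr p" using assms by (intro powr_mono2) auto
  also have "\<dots> = 2 powr p * ?m powr p" by (rule powr_mult)
  also have "?m powr p \<le> \<bar>a\<bar> powr p + \<bar>b\<bar> powr p" by (simp add: max_def)
  finally show ?thesis by simp
qed

text \<open>Taking the p-th power undoes the root where \<open>weighted_spikes\<close> is
  nonnegative, which is known only off the null set of points in infinitely many spikes.\<close>

lemma integrable_spiky_powr:
  assumes "1 \<le> p"
  shows "integrable circle_measure (\<lambda>x. \<bar>spiky p x\<bar> powr p)"
proof -
  have "AE x in circle_measure. weighted_spikes x = \<bar>spiky p x\<bar> powr p"
    using AE_finitely_many_spikes_0
    by (rule AE_mp) (use assms in \<open>auto intro!: AE_I2 dest: weighted_spikes_nonneg simp: spiky_def powr_powr\<close>)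
  then show ?thesis
    by (rule integrable_cong_AE_imp[OF integrable_weighted_spikes, rotated])
       (auto intro!: borel_measurable_circle)
qed

lemma integrable_spiky:
  assumes "1 \<le> p"
  shows "integrable circle_measure (spiky p)"
proof (rule Bochner_Integration.integrable_bound)
  show "integrable circle_measure (\<lambda>x. 1 + \<bar>spiky p x\<bar> powr p)"
    using integrable_spiky_powr[OF assms] by simp
  have "\<bar>y\<bar> \<le> 1 + \<bar>y\<bar> powr p" for y :: real
  proof (cases "\<bar>y\<bar> \<le> 1")
    case False
    then show ?thesis using powr_mono[of 1 p "\<bar>y\<bar>"] assms by simp
  qed (simp add: add_increasing2)
  then show "AE x in circle_measure. norm (spiky p x) \<le> norm (1 + \<bar>spiky p x\<bar> powr p)"
    by (simp add: add_nonneg_nonneg)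
qed (auto intro: borel_measurable_circle)

text \<open>Centring costs a fixed constant per term, which the growing height of the spikes
  absorbs.\<close>

definition extremal :: "real \<Rightarrow> real \<Rightarrow> real" where
  "extremal p x = spiky p x - integral\<^sup>L circle_measure (spiky p)"

lemma integral_extremal: "1 \<le> p \<Longrightarrow> integral\<^sup>L circle_measure (extremal p) = 0"
  unfolding extremal_def using circle.prob_space by (simp add: integrable_spiky)

lemma extremal_Lp:
  assumes "1 \<le> p"
  shows "extremal p \<in> Lp_circle p"
proof -
  let ?C = "integral\<^sup>L circle_measure (spiky p)"
  have meas: "extremal p \<in> borel_measurable borel" unfolding extremal_def by measurable
  have "integrable circle_measure (\<lambda>x. \<bar>extremal p x\<bar> powr p)"
  proof (rule Bochner_Integration.integrable_bound)
    show "integrable circle_measure (\<lambda>x. 2 powr p * (\<bar>spiky p x\<bar> powr p + \<bar>?C\<bar> powr p))"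
      using integrable_spiky_powr[OF assms] by simp
    show "AE x in circle_measure. norm (\<bar>extremal p x\<bar> powr p)
        \<le> norm (2 powr p * (\<bar>spiky p x\<bar> powr p + \<bar>?C\<bar> powr p))"
      unfolding extremal_def using powr_diff_le[of p _ ?C] assms by (auto simp: abs_mult)
  qed (use meas in \<open>auto intro!: borel_measurable_circle\<close>)
  then show ?thesis
    by (simp add: Lp_circle_def borel_measurable_circle[OF meas]) (simp add: extremal_def spiky_def)
qed

section \<open>Growth of the sums\<close>

text \<open>\<open>N\<close> is the last index of block \<open>k\<close>, so that block contains
  more than half of all indices. Its terms have full spike height, and the earlier values of
  \<open>spiky\<close> are nonnegative.\<close>

lemma sum_extremal_ge:
  assumes good: "\<And>b. \<forall>\<^sub>F i in sequentially. 2 ^ b * x \<notin> spike i"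
    and hit: "x \<in> hit k" and p: "0 < p"
  defines "i \<equiv> floor_log k" and "N \<equiv> 2 ^ Suc k - 1 :: nat"
  shows "N * ((2 ^ i / (real i + 1)\<^sup>2) powr (1 / p) / 2 - integral\<^sup>L circle_measure (spiky p))
    \<le> (\<Sum>j=1..N. extremal p (real (2 ^ dilation_exp j) * x))"
proof -
  let ?l = "(2 ^ i / (real i + 1)\<^sup>2) powr (1 / p)"
  have "real N * (?l / 2) \<le> 2 ^ k * ?l"
    by (simp add: N_def of_nat_diff algebra_simps)
  also have "\<dots> = (\<Sum>j=2^k..N. ?l)"
    by (simp add: N_def)
  also have "\<dots> \<le> (\<Sum>j=2^k..N. spiky p (2 ^ dilation_exp j * x))"
  proof (rule sum_mono)
    fix j assume "j \<in> {2^k..N}"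
    moreover have "Suc N = 2 ^ Suc k" by (simp add: N_def)
    ultimately have "2 ^ k \<le> j" "j < 2 ^ Suc k" by auto
    from hit_imp_spike[OF hit this] have "2 ^ i / (real i + 1)\<^sup>2 \<le> weighted_spikes (2 ^ dilation_exp j * x)"
      unfolding i_def by (rule weighted_spikes_ge[OF good])
    then show "?l \<le> spiky p (2 ^ dilation_exp j * x)"
      unfolding spiky_def using p by (intro powr_mono2) auto
  qed
  also have "\<dots> \<le> (\<Sum>j=1..N. spiky p (2 ^ dilation_exp j * x))"
    by (rule sum_mono2) (auto simp: spiky_def Suc_le_eq intro: order_less_le_trans)
  finally show ?thesis by (simp add: extremal_def sum_subtractf algebra_simps)
qed

lemma tendsto_geometric_powr_times_powr:
  fixes \<epsilon> s :: real
  assumes "0 < \<epsilon>"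
  shows "(\<lambda>i. (2 ^ i) powr (- \<epsilon>) * (real i + 1) powr s) \<longlonglongrightarrow> 0"
proof -
  have "((\<lambda>x. exp (- (\<epsilon> * ln 2) * x) * (x + 1) powr s) \<longlongrightarrow> 0) at_top"
  proof -
    define d where "d = \<epsilon> * ln 2"
    have "0 < d" using assms by (simp add: d_def)
    then show ?thesis unfolding d_def[symmetric] by real_asymp
  qed
  from filterlim_compose[OF this filterlim_real_sequentially]
  show ?thesis by (simp add: powr_def ln_realpow mult_ac)
qed

text \<open>At the end of a block of group \<open>i\<close>, \<open>ln N\<close> lies between
  \<open>2 ^ i / 2\<close> and \<open>2 * 2 ^ i\<close>, so for \<open>K \<ge> 0\<close> the left
  side bounds \<open>K * ln N powr (1 / p - \<epsilon>)\<close>. Relative to the spike height it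
  decays like \<open>(2 ^ i) powr (- \<epsilon>)\<close> up to a power of
  \<open>i + 1\<close>.\<close>

lemma spike_height_dominates:
  assumes p: "0 < p" and \<epsilon>: "0 < (\<epsilon>::real)"
  shows "\<forall>\<^sub>F i in sequentially. K * ((2 * 2 ^ i) powr (1 / p) * (2 ^ i / 2) powr (- \<epsilon>))
     < (2 ^ i / (real i + 1)\<^sup>2) powr (1 / p) / 2 - C"
proof -
  define c where "c = 1 / p"
  let ?q = "\<lambda>i. (real i + 1) powr (2 * c)"
  have c: "0 < c" using p by (simp add: c_def)
  \<comment> \<open>The claim divided by the spike height \<open>u powr c / ?q i\<close>, with the
    constant \<open>C\<close> moved to the left; 1/2 remains on the right.\<close>
  have "(\<lambda>i. K * 2 powr c * 2 powr \<epsilon> * ((2 ^ i) powr (- \<epsilon>) * ?q i) + C * ((2 ^ i) powr (- c) * ?q i))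
      \<longlonglongrightarrow> K * 2 powr c * 2 powr \<epsilon> * 0 + C * 0"
    by (intro tendsto_intros tendsto_geometric_powr_times_powr \<epsilon> c)
  then have "\<forall>\<^sub>F i in sequentially.
      K * 2 powr c * 2 powr \<epsilon> * ((2 ^ i) powr (- \<epsilon>) * ?q i) + C * ((2 ^ i) powr (- c) * ?q i) < 1 / 2"
    by (rule order_tendstoD) simp
  then show ?thesis
    unfolding c_def[symmetric]
  proof (rule eventually_mono)
    fix i :: nat
    define u :: real where "u = 2 ^ i"
    have u: "0 < u" by (simp add: u_def)
    have q: "0 < ?q i" by simp
    have h: "(u / (real i + 1)\<^sup>2) powr c = u powr c / ?q i"
      using u by (simp add: powr_divide powr_powr flip: powr_numeral)
    have inv: "u powr c * u powr (- c) = 1" using u by (simp flip: powr_add)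
    assume "K * 2 powr c * 2 powr \<epsilon> * ((2 ^ i) powr (- \<epsilon>) * ?q i) + C * ((2 ^ i) powr (- c) * ?q i) < 1 / 2"
    then have "(K * 2 powr c * 2 powr \<epsilon> * (u powr (- \<epsilon>) * ?q i) + C * (u powr (- c) * ?q i)) * (u powr c / ?q i)
       < 1 / 2 * (u powr c / ?q i)"
      unfolding u_def[symmetric] using u q by (intro mult_strict_right_mono) auto
    also have "(K * 2 powr c * 2 powr \<epsilon> * (u powr (- \<epsilon>) * ?q i) + C * (u powr (- c) * ?q i)) * (u powr c / ?q i)
       = K * (2 powr c * u powr c * (2 powr \<epsilon> * u powr (- \<epsilon>))) + C * (u powr c * u powr (- c))"
      using q by (simp add: field_simps)
    also have "2 powr c * u powr c = (2 * u) powr c" using u by (simp add: powr_mult)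
    also have "2 powr \<epsilon> * u powr (- \<epsilon>) = (u / 2) powr (- \<epsilon>)"
      using u by (simp add: powr_divide powr_minus field_simps)
    finally show "K * ((2 * 2 ^ i) powr c * (2 ^ i / 2) powr (- \<epsilon>)) < (2 ^ i / (real i + 1)\<^sup>2) powr c / 2 - C"
      unfolding u_def[symmetric] h inv by simp
  qed
qed

lemma limsup_extremal:
  assumes good: "\<And>b. \<forall>\<^sub>F i in sequentially. 2 ^ b * x \<notin> spike i"
    and hits: "\<exists>\<^sub>F k in sequentially. x \<in> hit k" and p: "0 < p" and \<epsilon>: "0 < \<epsilon>"
  shows "limsup (\<lambda>N. ereal ((\<Sum>j=1..N. extremal p (real (2 ^ dilation_exp j) * x)) /
                               (real N * ln (real N) powr (1 / p - \<epsilon>)))) = \<infinity>"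
    (is "limsup ?r = _")
proof (rule ccontr)
  assume "limsup ?r \<noteq> \<infinity>"
  then obtain K0 where "limsup ?r < ereal K0"
    using less_PInf_Ex_of_nat by blast
  then have ev: "\<forall>\<^sub>F N in sequentially. ?r N < ereal K0" by (rule Limsup_lessD)
  \<comment> \<open>Truncating at 0 keeps multiplication by \<open>K\<close> monotone.\<close>
  define K where "K = max 0 K0"
  let ?C = "integral\<^sup>L circle_measure (spiky p)"
  let ?N = "\<lambda>k. 2 ^ Suc k - 1 :: nat"
  have "filterlim ?N at_top sequentially" by real_asymp
  then have ev1: "\<forall>\<^sub>F k in sequentially. ?r (?N k) < ereal K0"
    using ev by (rule eventually_compose_filterlim[rotated])
  have "filterlim floor_log at_top sequentially"
    unfolding filterlim_at_top
  proof
    fix m show "\<forall>\<^sub>F k in sequentially. m \<le> floor_log k"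
      using eventually_ge_at_top[of "2 ^ m"]
      by (rule eventually_mono) (use floor_log_le_iff[of "2 ^ m"] in auto)
  qed
  then have ev2: "\<forall>\<^sub>F k in sequentially. K * ((2 * 2 ^ floor_log k) powr (1 / p) * (2 ^ floor_log k / 2) powr (- \<epsilon>))
     < (2 ^ floor_log k / (real (floor_log k) + 1)\<^sup>2) powr (1 / p) / 2 - ?C"
    using spike_height_dominates[OF p \<epsilon>] by (rule eventually_compose_filterlim[rotated])
  obtain k where k: "x \<in> hit k" "?r (?N k) < ereal K0"
    "K * ((2 * 2 ^ floor_log k) powr (1 / p) * (2 ^ floor_log k / 2) powr (- \<epsilon>))
     < (2 ^ floor_log k / (real (floor_log k) + 1)\<^sup>2) powr (1 / p) / 2 - ?C"
    "1 \<le> k"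
    using frequently_ex[OF frequently_eventually_frequently[OF hits
       eventually_conj[OF ev1 eventually_conj[OF ev2 eventually_ge_at_top[of 1]]]]]
    by (elim exE conjE) (rule that)
  define i where "i = floor_log k"
  define L where "L = ln (real (?N k))"
  have N: "2 ^ k \<le> real (?N k)" "real (?N k) < 2 ^ Suc k" by (simp_all add: of_nat_diff)
  have ki: "2 ^ i \<le> k" "Suc k \<le> 2 * 2 ^ i"
    using k(4) floor_log_exp2_le[of k] floor_log_exp2_gt[of k] by (auto simp: i_def)
  have Npos: "0 < real (?N k)" by (rule order_less_le_trans[OF _ N(1)]) simp
  have "ln (2 ^ k) \<le> L" unfolding L_def by (rule ln_mono[OF N(1)]) simp
  then have "real k * ln 2 \<le> L" by (simp add: ln_realpow)
  \<comment> \<open>From \<open>ln y \<le> y - 1\<close> at \<open>y = 1 / 2\<close>.\<close>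
  moreover have "(1/2::real) \<le> ln 2" using ln_le_minus_one[of "1 / 2::real"] by (simp add: ln_div)
  ultimately have "real k * (1 / 2) \<le> L"
    using mult_left_mono[of "1 / 2" "ln 2" "real k"] by linarith
  moreover have "2 ^ i \<le> real k" using ki(1) by (metis of_nat_le_iff of_nat_numeral of_nat_power)
  ultimately have L1: "2 ^ i / 2 \<le> L" by linarith
  have "L \<le> ln (2 ^ Suc k)" unfolding L_def by (rule ln_mono[OF less_imp_le[OF N(2)] Npos])
  also have "\<dots> = real (Suc k) * ln 2" by (rule ln_realpow)
  also have "\<dots> \<le> real (Suc k) * 1" by (intro mult_left_mono) (auto simp: ln_2_less_1 less_imp_le)
  also have "\<dots> \<le> 2 * 2 ^ i" using of_nat_mono[OF ki(2), where 'a = real] by simp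
  finally have L2: "L \<le> 2 * 2 ^ i" .
  have Lpos: "0 < L" using L1 by (rule order_less_le_trans[rotated]) simp
  \<comment> \<open>The sign of \<open>1 / p - \<epsilon>\<close> is open, so the factors are
    bounded separately: \<open>L2\<close> serves the positive exponent, \<open>L1\<close> the
    negative one.\<close>
  have "L powr (1 / p - \<epsilon>) = L powr (1 / p) * L powr (- \<epsilon>)" by (simp flip: powr_add)
  also have "\<dots> \<le> (2 * 2 ^ i) powr (1 / p) * (2 ^ i / 2) powr (- \<epsilon>)"
    using L1 L2 Lpos p \<epsilon> by (intro mult_mono powr_mono2 powr_mono2') auto
  finally have "K * L powr (1 / p - \<epsilon>) \<le> K * ((2 * 2 ^ i) powr (1 / p) * (2 ^ i / 2) powr (- \<epsilon>))"
    by (rule mult_left_mono) (simp add: K_def)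
  also have "\<dots> < (2 ^ i / (real i + 1)\<^sup>2) powr (1 / p) / 2 - ?C"
    using k(3) by (simp add: i_def)
  finally have "real (?N k) * (K * L powr (1 / p - \<epsilon>)) \<le> real (?N k) * ((2 ^ i / (real i + 1)\<^sup>2) powr (1 / p) / 2 - ?C)"
    by (rule mult_left_mono[OF less_imp_le]) (rule of_nat_0_le_iff)
  also have "\<dots> \<le> (\<Sum>j=1..?N k. extremal p (real (2 ^ dilation_exp j) * x))"
    using sum_extremal_ge[OF good k(1) p] by (simp add: i_def)
  finally have le: "real (?N k) * (K * L powr (1 / p - \<epsilon>))
      \<le> (\<Sum>j=1..?N k. extremal p (real (2 ^ dilation_exp j) * x))" .
  have "0 < real (?N k) * L powr (1 / p - \<epsilon>)"
    using Npos Lpos by (intro mult_pos_pos) auto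
  then have "K \<le> (\<Sum>j=1..?N k. extremal p (real (2 ^ dilation_exp j) * x)) / (real (?N k) * L powr (1 / p - \<epsilon>))"
    using le by (simp only: pos_le_divide_eq mult.left_commute)
  then show False using k(2) unfolding L_def K_def by simp
qed

text \<open>The two almost sure events do not involve \<open>\<epsilon>\<close>, so one null set
  serves every \<open>\<epsilon>\<close>.\<close>

lemma AE_limsup_extremal:
  assumes "1 \<le> p"
  shows "AE x in circle_measure. \<forall>\<epsilon>::real. \<epsilon> > 0 \<longrightarrow>
            limsup (\<lambda>N. ereal ((\<Sum>j=1..N. extremal p (real (2 ^ dilation_exp j) * x)) /
                               (real N * ln (real N) powr (1 / p - \<epsilon>)))) = \<infinity>"
  using AE_finitely_many_spikes AE_infinitely_many_hits
proof eventually_elim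
  case (elim x)
  then show ?case using assms by (intro allI impI limsup_extremal) simp_all
qed

text \<open>The case \<open>p = 2\<close>, \<open>\<epsilon> = 1 / 4\<close>:
  \<open>sqrt (ln (ln N))\<close> grows more slowly than \<open>ln N powr (1 / 4)\<close>.\<close>

lemma smallo_imp_limsup_finite:
  fixes S :: "nat \<Rightarrow> real"
  assumes "S \<in> o(\<lambda>N. real N * sqrt (ln (ln (real N))))"
  shows "limsup (\<lambda>N. ereal (S N / (real N * ln (real N) powr (1 / 2 - 1 / 4)))) = 0"
proof -
  have "(\<lambda>N. real N * sqrt (ln (ln (real N)))) \<in> O(\<lambda>N. real N * ln (real N) powr (1 / 2 - 1 / 4))"
    by real_asymp
  with assms have "S \<in> o(\<lambda>N. real N * ln (real N) powr (1 / 2 - 1 / 4))"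
    by (rule landau_o.small_big_trans)
  then have "(\<lambda>N. S N / (real N * ln (real N) powr (1 / 2 - 1 / 4))) \<longlonglongrightarrow> 0"
    by (rule smalloD_tendsto)
  then have "(\<lambda>N. ereal (S N / (real N * ln (real N) powr (1 / 2 - 1 / 4)))) \<longlonglongrightarrow> ereal 0"
    by (simp only: lim_ereal)
  from lim_imp_Limsup[OF _ this] show ?thesis by (simp add: zero_ereal_def)
qed

theorem theorem1p6:
  "(\<forall>p::real. 2 \<le> p \<longrightarrow>
      (\<exists>(f :: real \<Rightarrow> real) (n :: nat \<Rightarrow> nat).
         f \<in> Lp_circle p \<and> integral\<^sup>L circle_measure f = 0 \<and> lacunary2 n \<and>
         (AE x in circle_measure. \<forall>\<epsilon>::real. \<epsilon> > 0 \<longrightarrow>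
            limsup (\<lambda>N. ereal ((\<Sum>j=1..N. f (real (n j) * x)) /
                               (real N * ln (real N) powr (1 / p - \<epsilon>)))) = \<infinity>)))
   \<and> (\<exists>(f :: real \<Rightarrow> real) (n :: nat \<Rightarrow> nat).
         f \<in> Lp_circle 2 \<and> integral\<^sup>L circle_measure f = 0 \<and> lacunary2 n \<and>
         (AE x in circle_measure. \<forall>\<epsilon>::real. \<epsilon> > 0 \<longrightarrow>
            limsup (\<lambda>N. ereal ((\<Sum>j=1..N. f (real (n j) * x)) /
                               (real N * ln (real N) powr (1 / 2 - \<epsilon>)))) = \<infinity>) \<and>
         \<not> (AE x in circle_measure.
              (\<lambda>N. \<Sum>j=1..N. f (real (n j) * x))
                \<in> o(\<lambda>N. real N * sqrt (ln (ln (real N))))))"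
proof (intro conjI allI impI)
  fix p :: real
  assume "2 \<le> p"
  then show "\<exists>(f :: real \<Rightarrow> real) (n :: nat \<Rightarrow> nat).
         f \<in> Lp_circle p \<and> integral\<^sup>L circle_measure f = 0 \<and> lacunary2 n \<and>
         (AE x in circle_measure. \<forall>\<epsilon>::real. \<epsilon> > 0 \<longrightarrow>
            limsup (\<lambda>N. ereal ((\<Sum>j=1..N. f (real (n j) * x)) /
                               (real N * ln (real N) powr (1 / p - \<epsilon>)))) = \<infinity>)"
    using extremal_Lp integral_extremal lacunary2_power_dilation_exp AE_limsup_extremal
    by (intro exI[of _ "extremal p"] exI[of _ "\<lambda>j. 2 ^ dilation_exp j"] conjI) auto
next
  let ?S = "\<lambda>x N. \<Sum>j=1..N. extremal 2 (real (2 ^ dilation_exp j) * x)"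
  have "\<not> (AE x in circle_measure. ?S x \<in> o(\<lambda>N. real N * sqrt (ln (ln (real N)))))"
  proof
    assume "AE x in circle_measure. ?S x \<in> o(\<lambda>N. real N * sqrt (ln (ln (real N))))"
    \<comment> \<open>At almost every point the limsup for \<open>\<epsilon> = 1 / 4\<close> would
      be both 0 and infinite, which a probability space excludes.\<close>
    then have "AE x in circle_measure. False"
      using AE_limsup_extremal[of 2, simplified]
    proof eventually_elim
      case (elim x)
      from elim(2)[rule_format, of "1 / 4"] smallo_imp_limsup_finite[OF elim(1)]
      show False by simp
    qed
    then show False by simp
  qed
  then show "\<exists>(f :: real \<Rightarrow> real) (n :: nat \<Rightarrow> nat).
         f \<in> Lp_circle 2 \<and> integral\<^sup>L circle_measure f = 0 \<and> lacunary2 n \<and>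
         (AE x in circle_measure. \<forall>\<epsilon>::real. \<epsilon> > 0 \<longrightarrow>
            limsup (\<lambda>N. ereal ((\<Sum>j=1..N. f (real (n j) * x)) /
                               (real N * ln (real N) powr (1 / 2 - \<epsilon>)))) = \<infinity>) \<and>
         \<not> (AE x in circle_measure.
              (\<lambda>N. \<Sum>j=1..N. f (real (n j) * x))
                \<in> o(\<lambda>N. real N * sqrt (ln (ln (real N)))))"
    using extremal_Lp[of 2] integral_extremal[of 2] lacunary2_power_dilation_exp AE_limsup_extremal[of 2]
    by (intro exI[of _ "extremal 2"] exI[of _ "\<lambda>j. 2 ^ dilation_exp j"] conjI) auto
qed

end
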